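(* Let $(e_n)$ be a seminormalized quasisubsymmetric basic sequence in a Banach space. Then there exists a constant $S>0$ such that for any two increasing sequences $(k_n)$ and $(\ell_n)$ of positive integers with $k_n\le \ell_n$ for all $n$, we have $$\Big\|\sum_n a_n e_{\ell_n}\Big\|\le S\Big\|\sum_n a_n e_{k_n}\Big\|\quad\text{for all }(a_n)\in c_{00}.$$
   Context: $c_{00}$ denotes the space of finitely supported scalar sequences. A sequence $(e_n)$ is seminormalized if $0<\inf_n\|e_n\|\le\sup_n\|e_n\|<\infty$. For basic sequences $(x_n),(y_n)$ and $C>0$, $(x_n)$ $C$-dominates $(y_n)$ if $\|\sum a_ny_n\|\le C\|\sum a_nx_n\|$ for all $(a_n)\in c_{00}$; $(x_n)$ dominates $(y_n)$ if it $C$-dominates it for some $C>0$. A basic sequence $(e_n)$ is quasisubsymmetric if for any two increasing sequences $(k_n)$ and $(\ell_n)$ of positive integers with $k_n\le\ell_n$ for all $n$, $(e_{k_n})$ dominates $(e_{\ell_n})$ (with a constant that may depend on the two sequences). *)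

theory Defs
  imports "HOL-Analysis.Analysis"
begin

text \<open>Real Banach spaces; sequences indexed by nat (index 0 plays the role of 1).\<close>

definition schauder_basis_of :: "(nat \<Rightarrow> 'a::real_normed_vector) \<Rightarrow> 'a set \<Rightarrow> bool" where
  "schauder_basis_of e X \<longleftrightarrow> range e \<subseteq> X \<and>
     (\<forall>x\<in>X. \<exists>!a::nat \<Rightarrow> real. (\<lambda>n. \<Sum>i<n. a i *\<^sub>R e i) \<longlonglongrightarrow> x)"

definition basic_sequence :: "(nat \<Rightarrow> 'a::real_normed_vector) \<Rightarrow> bool" where
  "basic_sequence e \<longleftrightarrow> schauder_basis_of e (closure (span (range e)))"

definition seminormalized :: "(nat \<Rightarrow> 'a::real_normed_vector) \<Rightarrow> bool" where
  "seminormalized e \<longleftrightarrow> 0 < (INF n. norm (e n)) \<and> bdd_above (range (\<lambda>n. norm (e n)))"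

text \<open>x C-dominates y; finitely supported coefficient sequences are those vanishing from some N on,
  so it suffices to quantify over all coefficient functions and all truncation lengths N.\<close>
definition dominates_with :: "real \<Rightarrow> (nat \<Rightarrow> 'a::real_normed_vector) \<Rightarrow> (nat \<Rightarrow> 'a) \<Rightarrow> bool" where
  "dominates_with C x y \<longleftrightarrow>
     (\<forall>(a::nat \<Rightarrow> real) N. norm (\<Sum>n<N. a n *\<^sub>R y n) \<le> C * norm (\<Sum>n<N. a n *\<^sub>R x n))"

definition dominates :: "(nat \<Rightarrow> 'a::real_normed_vector) \<Rightarrow> (nat \<Rightarrow> 'a) \<Rightarrow> bool" where
  "dominates x y \<longleftrightarrow> (\<exists>C>0. dominates_with C x y)"

definition quasisubsymmetric :: "(nat \<Rightarrow> 'a::real_normed_vector) \<Rightarrow> bool" where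
  "quasisubsymmetric e \<longleftrightarrow> basic_sequence e \<and>
     (\<forall>k l::nat \<Rightarrow> nat. strict_mono k \<and> strict_mono l \<and> (\<forall>n. k n \<le> l n) \<longrightarrow>
        dominates (e \<circ> k) (e \<circ> l))"

end

theory Submission
  imports Defs
begin

text \<open>
  The partial-sum projections of a basic sequence are uniformly bounded. Indeed, the basis norm
  sup_n ||P_n x|| is finite on the closed span, so by Baire category one of its sublevel sets is
  dense in a ball, and the successive-approximation argument of the open mapping theorem bounds it
  by a multiple of ||x||. Hence each coefficient a_n of a finite sum over a subsequence of the
  basis is bounded by a fixed multiple of the norm of the sum, uniformly in the subsequence once
  the basis is seminormalized.

  A gliding hump argument turns quasisubsymmetry into a single constant C that works for all
  pairs k <= l with k_0 beyond some p: otherwise one could choose pairs violating the constants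
  1, 2, 3, ..., each starting beyond the previous one, and glue them blockwise into a single pair
  for which no constant works. For an arbitrary pair, at most p terms have k_n < p; these are
  estimated by the coefficient bound, and the remaining tail by C.
\<close>

lemma subspace_closure:
  fixes S :: "'a::real_normed_vector set"
  assumes "subspace S"
  shows "subspace (closure S)"
  unfolding subspace_def
proof (intro conjI ballI allI)
  show "0 \<in> closure S"
    using assms closure_subset subspace_0 by blast
next
  fix x y assume "x \<in> closure S" "y \<in> closure S"
  then have "x + y \<in> closure (S + S)"
    using closure_sum by (blast intro: set_plus_intro)
  moreover have "S + S \<subseteq> S"
    using assms by (auto simp: set_plus_def subspace_add)
  ultimately show "x + y \<in> closure S"
    using closure_mono by blast
next
  fix c and x assume "x \<in> closure S"
  then have "c *\<^sub>R x \<in> closure ((*\<^sub>R) c ` S)"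
    by (metis closure_scaleR image_eqI)
  moreover have "(*\<^sub>R) c ` S \<subseteq> S"
    using assms by (auto simp: subspace_scale)
  ultimately show "c *\<^sub>R x \<in> closure S"
    using closure_mono by blast
qed

lemma halving_approximation_sums:
  fixes f :: "'a::real_normed_vector \<Rightarrow> real"
  assumes approx: "\<And>u. u \<in> S \<Longrightarrow> \<exists>w\<in>S. f w \<le> A * norm u \<and> norm (u - w) \<le> norm u / 2"
    and diff: "\<And>u w. u \<in> S \<Longrightarrow> w \<in> S \<Longrightarrow> u - w \<in> S"
    and "0 \<le> A" and "y \<in> S"
  obtains z where "\<And>j. z j \<in> S" "z sums y" "\<And>j. f (z j) \<le> A * norm y * (1/2) ^ j"
proof -
  obtain w where w: "\<And>u. u \<in> S \<Longrightarrow>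
      w u \<in> S \<and> f (w u) \<le> A * norm u \<and> norm (u - w u) \<le> norm u / 2"
    using approx by metis
  define r where "r j = ((\<lambda>u. u - w u) ^^ j) y" for j
  have r_Suc: "r (Suc j) = r j - w (r j)" for j
    by (simp add: r_def)
  have r_in: "r j \<in> S" for j
    by (induction j) (auto simp: r_Suc r_def \<open>y \<in> S\<close> w diff)
  have r_norm: "norm (r j) \<le> norm y * (1/2) ^ j" for j
  proof (induction j)
    case (Suc j)
    then show ?case
      using w[OF r_in[of j]] by (simp add: r_Suc)
  qed (simp add: r_def)
  have "r \<longlonglongrightarrow> 0"
    by (rule Lim_null_comparison[OF always_eventually[OF allI[OF r_norm]]])
       (intro tendsto_mult_right_zero LIMSEQ_power_zero, simp)
  then have "(\<lambda>J. y - r J) \<longlonglongrightarrow> y - 0"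
    by (intro tendsto_diff tendsto_const)
  moreover have partial_sums: "(\<Sum>j<J. w (r j)) = y - r J" for J
    by (induction J) (auto simp: r_Suc r_def)
  ultimately have "(\<lambda>j. w (r j)) sums y"
    unfolding sums_def partial_sums by simp
  moreover have "f (w (r j)) \<le> A * norm y * (1/2) ^ j" for j
    using w[OF r_in[of j]] mult_left_mono[OF r_norm[of j] \<open>0 \<le> A\<close>] by (simp add: mult.assoc)
  moreover have "w (r j) \<in> S" for j
    using w[OF r_in[of j]] by blast
  ultimately show thesis
    by (rule that[rotated])
qed

lemma Baire_closed_cover:
  fixes S :: "'a::banach set" and F :: "nat \<Rightarrow> 'a set"
  assumes "closed S" "S \<noteq> {}" "\<And>K. closed (F K)" "\<And>K. F K \<subseteq> S" "S \<subseteq> (\<Union>K. F K)"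
  obtains x0 r K where "x0 \<in> S" "0 < r" "\<And>y. y \<in> S \<Longrightarrow> dist y x0 < r \<Longrightarrow> y \<in> F K"
proof -
  define T where "T = top_of_set S"
  have complete: "completely_metrizable_space T"
    unfolding T_def
    by (rule completely_metrizable_space_closedin[OF completely_metrizable_space_euclidean])
       (simp add: \<open>closed S\<close>)
  have "\<Union>(range F) = S"
    using assms(4,5) by blast
  then have interior_union: "T interior_of \<Union>(range F) = S"
    using interior_of_topspace[of T] by (simp add: T_def)
  have "\<exists>K. T interior_of F K \<noteq> {}"
  proof (rule ccontr)
    assume "\<not> ?thesis"
    then have "T interior_of \<Union>(range F) = {}"
      using assms(3,4) by (intro Baire_category_alt[OF disjI1[OF complete]]) (auto simp: T_def closed_subset)
    then show False
      using interior_union \<open>S \<noteq> {}\<close> by blast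
  qed
  then obtain K x0 where "x0 \<in> T interior_of F K"
    by blast
  then obtain U where U: "openin T U" "x0 \<in> U" "U \<subseteq> F K"
    unfolding interior_of_def by blast
  then obtain r where "0 < r" "\<And>y. y \<in> S \<Longrightarrow> dist y x0 < r \<Longrightarrow> y \<in> U"
    unfolding T_def openin_euclidean_subtopology_iff by blast
  moreover have "x0 \<in> S"
    using U assms(4) by blast
  ultimately show thesis
    using that U(3) by blast
qed

lemma sum_lessThan_split_at:
  fixes f :: "nat \<Rightarrow> 'a::comm_monoid_add"
  shows "(\<Sum>n<N. f n) = (\<Sum>n<min N h. f n) + (\<Sum>i<N - h. f (h + i))"
proof (cases "N \<le> h")
  case False
  have "(\<Sum>n<N. f n) = (\<Sum>n<h. f n) + (\<Sum>n\<in>{h..<N}. f n)"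
    using False by (simp add: lessThan_atLeast0 sum.atLeastLessThan_concat)
  moreover have "(\<Sum>n\<in>{h..<N}. f n) = (\<Sum>i<N - h. f (h + i))"
    using sum.shift_bounds_nat_ivl[of f 0 h "N - h"] False by (simp add: lessThan_atLeast0 add.commute)
  ultimately show ?thesis
    using False by simp
qed simp

lemma norm_sum_scaleR_le:
  fixes x :: "nat \<Rightarrow> 'a::real_normed_vector"
  assumes "\<And>n. n < H \<Longrightarrow> \<bar>a n\<bar> \<le> D" and "\<And>n. norm (x n) \<le> E" and "0 \<le> D"
  shows "norm (\<Sum>n<H. a n *\<^sub>R x n) \<le> H * (D * E)"
proof -
  have "norm (\<Sum>n<H. a n *\<^sub>R x n) \<le> (\<Sum>n<H. \<bar>a n\<bar> * norm (x n))"
    using norm_sum[of "\<lambda>n. a n *\<^sub>R x n" "{..<H}"] by simp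
  also have "\<dots> \<le> (\<Sum>n<H. D * E)"
    using assms by (intro sum_mono mult_mono) auto
  finally show ?thesis
    by simp
qed

lemma dominates_withD:
  "dominates_with C x y \<Longrightarrow> norm (\<Sum>n<N. a n *\<^sub>R y n) \<le> C * norm (\<Sum>n<N. a n *\<^sub>R x n)"
  by (simp add: dominates_with_def)

section \<open>Gluing blocks of index sequences\<close>

definition subseq_pair_from :: "nat \<Rightarrow> (nat \<Rightarrow> nat) \<Rightarrow> (nat \<Rightarrow> nat) \<Rightarrow> bool" where
  "subseq_pair_from p k l \<longleftrightarrow> strict_mono k \<and> strict_mono l \<and> (\<forall>n. k n \<le> l n) \<and> p \<le> k 0"

definition block_start :: "(nat \<Rightarrow> nat) \<Rightarrow> nat \<Rightarrow> nat" where
  "block_start M j = (\<Sum>i<j. M i)"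

definition block_of :: "(nat \<Rightarrow> nat) \<Rightarrow> nat \<Rightarrow> nat" where
  "block_of M n = (LEAST j. n < block_start M (Suc j))"

text \<open>Block j of glue M f consists of the values f j 0, ..., f j (M j - 1), placed at the
  positions block_start M j, ..., block_start M (Suc j) - 1.\<close>

definition glue :: "(nat \<Rightarrow> nat) \<Rightarrow> (nat \<Rightarrow> nat \<Rightarrow> 'b) \<Rightarrow> nat \<Rightarrow> 'b" where
  "glue M f n = f (block_of M n) (n - block_start M (block_of M n))"

lemma block_start_Suc: "block_start M (Suc j) = block_start M j + M j"
  by (simp add: block_start_def)

lemma block_start_mono: "i \<le> j \<Longrightarrow> block_start M i \<le> block_start M j"
  unfolding block_start_def by (rule sum_mono2) auto

lemma block_of_eq:
  assumes "i < M j"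
  shows "block_of M (block_start M j + i) = j"
  unfolding block_of_def
proof (rule Least_equality)
  show "block_start M j + i < block_start M (Suc j)"
    using assms by (simp add: block_start_Suc)
next
  fix j' assume "block_start M j + i < block_start M (Suc j')"
  then show "j \<le> j'"
    using block_start_mono[of "Suc j'" j M] by (metis not_less_eq_eq trans_le_add1 leD)
qed

lemma glue_block: "i < M j \<Longrightarrow> glue M f (block_start M j + i) = f j i"
  by (simp add: glue_def block_of_eq)

lemma block_decomp:
  assumes "\<And>j. 0 < M j"
  obtains j i where "i < M j" "n = block_start M j + i"
proof -
  have "j \<le> block_start M j" for j
  proof (induction j)
    case (Suc j)
    then show ?case using assms[of j] by (simp add: block_start_Suc)
  qed (simp add: block_start_def)
  then have ex: "n < block_start M (Suc n)"
    by (metis Suc_le_eq)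
  define j where "j = block_of M n"
  have upper: "n < block_start M (Suc j)"
    unfolding j_def block_of_def by (rule LeastI[where P = "\<lambda>j. n < block_start M (Suc j)", OF ex])
  have lower: "block_start M j \<le> n"
  proof (cases j)
    case (Suc j')
    then have "\<not> n < block_start M (Suc j')"
      unfolding j_def block_of_def by (metis lessI not_less_Least)
    then show ?thesis using Suc by simp
  qed (simp add: block_start_def)
  show thesis
    by (rule that[of "n - block_start M j" j]) (use upper lower in \<open>auto simp: block_start_Suc\<close>)
qed

lemma strict_mono_glue:
  assumes pos: "\<And>j. 0 < M j" and mono: "\<And>j. strict_mono (f j)"
    and gap: "\<And>j i. i < M j \<Longrightarrow> f j i < f (Suc j) 0"
  shows "strict_mono (glue M f)"
  unfolding strict_mono_Suc_iff
proof
  fix n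
  obtain j i where i: "i < M j" and n: "n = block_start M j + i"
    by (rule block_decomp[OF pos])
  have "glue M f n = f j i"
    using n i by (simp add: glue_block)
  show "glue M f n < glue M f (Suc n)"
  proof (cases "Suc i < M j")
    case True
    then have "glue M f (Suc n) = f j (Suc i)"
      using glue_block[of "Suc i" M j f] n by simp
    then show ?thesis
      using \<open>glue M f n = f j i\<close> mono[of j] by (simp add: strict_mono_Suc_iff)
  next
    case False
    then have "Suc n = block_start M (Suc j) + 0"
      using i n by (simp add: block_start_Suc)
    then have "glue M f (Suc n) = f (Suc j) 0"
      using glue_block[of 0 M "Suc j" f] pos[of "Suc j"] by simp
    then show ?thesis
      using \<open>glue M f n = f j i\<close> gap[OF i] by simp
  qed
qed

lemma subseq_pair_glue:
  assumes pos: "\<And>j. 0 < M j" and pairs: "\<And>j. subseq_pair_from 0 (k j) (l j)"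
    and gap: "\<And>j. l j (M j) \<le> k (Suc j) 0"
  shows "subseq_pair_from 0 (glue M k) (glue M l)"
proof -
  have lk_gap: "l j i < k (Suc j) 0" if "i < M j" for j i
    using pairs[of j] that gap[of j] unfolding subseq_pair_from_def
    by (meson order_less_le_trans strict_monoD)
  have k_gap: "k j i < k (Suc j) 0" if "i < M j" for j i
    using pairs[of j] lk_gap[OF that] unfolding subseq_pair_from_def by (meson le_less_trans)
  have l_gap: "l j i < l (Suc j) 0" if "i < M j" for j i
    using pairs[of "Suc j"] lk_gap[OF that] unfolding subseq_pair_from_def by (meson less_le_trans)
  have "strict_mono (glue M k)"
    by (rule strict_mono_glue[where f = k, OF pos _ k_gap]) (use pairs in \<open>auto simp: subseq_pair_from_def\<close>)
  moreover have "strict_mono (glue M l)"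
    by (rule strict_mono_glue[where f = l, OF pos _ l_gap]) (use pairs in \<open>auto simp: subseq_pair_from_def\<close>)
  moreover have "glue M k n \<le> glue M l n" for n
    using pairs unfolding glue_def subseq_pair_from_def by blast
  ultimately show ?thesis
    by (simp add: subseq_pair_from_def)
qed

lemma sum_glue_block:
  fixes x :: "nat \<Rightarrow> 'a::real_vector"
  shows "(\<Sum>n<block_start M (Suc j). (if block_start M j \<le> n then b (n - block_start M j) else 0)
            *\<^sub>R x (glue M f n))
         = (\<Sum>i<M j. b i *\<^sub>R x (f j i))"
  by (subst sum_lessThan_split_at[where h = "block_start M j"])
     (auto simp: block_start_Suc glue_block intro!: sum.cong)


section \<open>Uniform domination of subsequences\<close>

lemma not_dominates_glue:
  fixes e :: "nat \<Rightarrow> 'a::real_normed_vector"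
  assumes viol: "\<And>j. (real j + 1) * norm (\<Sum>n<M j. a j n *\<^sub>R e (k j n)) < norm (\<Sum>n<M j. a j n *\<^sub>R e (l j n))"
  shows "\<not> dominates (e \<circ> glue M k) (e \<circ> glue M l)"
proof
  assume "dominates (e \<circ> glue M k) (e \<circ> glue M l)"
  then obtain C where C: "dominates_with C (e \<circ> glue M k) (e \<circ> glue M l)"
    unfolding dominates_def by blast
  obtain j :: nat where "C \<le> real j"
    using real_arch_simple by blast
  define b where "b n = (if block_start M j \<le> n then a j (n - block_start M j) else 0)" for n
  have "norm (\<Sum>n<block_start M (Suc j). b n *\<^sub>R e (glue M l n))
        \<le> C * norm (\<Sum>n<block_start M (Suc j). b n *\<^sub>R e (glue M k n))"
    using dominates_withD[OF C] by simp
  then have "norm (\<Sum>n<M j. a j n *\<^sub>R e (l j n)) \<le> C * norm (\<Sum>n<M j. a j n *\<^sub>R e (k j n))"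
    unfolding b_def sum_glue_block .
  also have "\<dots> \<le> (real j + 1) * norm (\<Sum>n<M j. a j n *\<^sub>R e (k j n))"
    using \<open>C \<le> real j\<close> by (intro mult_right_mono) auto
  finally show False
    using viol[of j] by simp
qed

lemma uniform_domination_from:
  fixes e :: "nat \<Rightarrow> 'a::real_normed_vector"
  assumes qs: "\<And>k l. subseq_pair_from 0 k l \<Longrightarrow> dominates (e \<circ> k) (e \<circ> l)"
  shows "\<exists>p C. C > 0 \<and> (\<forall>k l. subseq_pair_from p k l \<longrightarrow> dominates_with C (e \<circ> k) (e \<circ> l))"
proof (rule ccontr)
  assume neg: "\<not> ?thesis"
  have "\<forall>p j. \<exists>k l a N. subseq_pair_from p k l \<and>
      (real j + 1) * norm (\<Sum>n<N. a n *\<^sub>R e (k n)) < norm (\<Sum>n<N. a n *\<^sub>R e (l n))"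
  proof (intro allI)
    fix p j
    have "real j + 1 > 0"
      by simp
    then have "\<not> (\<forall>k l. subseq_pair_from p k l \<longrightarrow> dominates_with (real j + 1) (e \<circ> k) (e \<circ> l))"
      using neg by blast
    then show "\<exists>k l a N. subseq_pair_from p k l \<and>
      (real j + 1) * norm (\<Sum>n<N. a n *\<^sub>R e (k n)) < norm (\<Sum>n<N. a n *\<^sub>R e (l n))"
      unfolding dominates_with_def by (auto simp: not_le)
  qed
  then obtain kf lf af Nf where pair_f: "\<And>p j. subseq_pair_from p (kf p j) (lf p j)"
    and viol_f: "\<And>p j. (real j + 1) * norm (\<Sum>n<Nf p j. af p j n *\<^sub>R e (kf p j n))
                         < norm (\<Sum>n<Nf p j. af p j n *\<^sub>R e (lf p j n))"
    unfolding choice_iff by blast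
  \<comment> \<open>Block j is a violation of the constant j + 1 starting beyond the end of block j - 1.\<close>
  define p where "p = rec_nat 0 (\<lambda>j q. lf q j (Nf q j))"
  define k where "k j = kf (p j) j" for j
  define l where "l j = lf (p j) j" for j
  define a where "a j = af (p j) j" for j
  define M where "M j = Nf (p j) j" for j
  have viol: "(real j + 1) * norm (\<Sum>n<M j. a j n *\<^sub>R e (k j n)) < norm (\<Sum>n<M j. a j n *\<^sub>R e (l j n))"
    for j unfolding k_def l_def a_def M_def by (rule viol_f)
  have "0 < M j" for j
    using viol[of j] by (cases "M j") auto
  moreover have "subseq_pair_from 0 (k j) (l j)" for j
    using pair_f[of "p j" j] unfolding k_def l_def subseq_pair_from_def by simp
  moreover have "l j (M j) \<le> k (Suc j) 0" for j
    using pair_f[of "p (Suc j)" "Suc j"] unfolding k_def l_def M_def subseq_pair_from_def p_def by simp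
  ultimately have "dominates (e \<circ> glue M k) (e \<circ> glue M l)"
    by (intro qs subseq_pair_glue)
  then show False
    using not_dominates_glue[OF viol] by blast
qed

lemma dominates_with_of_tail:
  fixes e :: "nat \<Rightarrow> 'a::real_normed_vector"
  assumes coeff: "\<And>k (a :: nat \<Rightarrow> real) N n. strict_mono k \<Longrightarrow> n < N \<Longrightarrow>
      \<bar>a n\<bar> \<le> B * norm (\<Sum>m<N. a m *\<^sub>R e (k m))"
    and bound: "\<And>i. norm (e i) \<le> E"
    and tail: "\<And>k l. subseq_pair_from p k l \<Longrightarrow> dominates_with C (e \<circ> k) (e \<circ> l)"
    and "0 \<le> B" "0 \<le> C"
    and kl: "subseq_pair_from 0 k l"
  shows "dominates_with (p * B * E + C * (1 + p * B * E)) (e \<circ> k) (e \<circ> l)"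
  unfolding dominates_with_def comp_def
proof (intro allI)
  fix a :: "nat \<Rightarrow> real" and N
  define X where "X = norm (\<Sum>n<N. a n *\<^sub>R e (k n))"
  define h where "h = (LEAST n. p \<le> k n)"
  have k: "strict_mono k"
    using kl by (auto simp: subseq_pair_from_def)
  have "p \<le> k p"
    using k by (rule strict_mono_imp_increasing)
  then have "p \<le> k h" and "h \<le> p"
    unfolding h_def by (auto intro: LeastI Least_le)
  have "0 \<le> E"
    using bound[of 0] norm_ge_zero order_trans by blast
  have head: "norm (\<Sum>n<min N h. a n *\<^sub>R e (m n)) \<le> p * B * E * X" for m
  proof -
    have "norm (\<Sum>n<min N h. a n *\<^sub>R e (m n)) \<le> min N h * (B * X * E)"
      using coeff[OF k, of _ N a] bound \<open>0 \<le> B\<close> by (intro norm_sum_scaleR_le) (auto simp: X_def)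
    also have "\<dots> \<le> p * (B * X * E)"
      using \<open>h \<le> p\<close> \<open>0 \<le> B\<close> \<open>0 \<le> E\<close> by (intro mult_right_mono) (auto simp: X_def)
    finally show ?thesis
      by (simp add: mult_ac)
  qed
  have shifted: "subseq_pair_from p (\<lambda>i. k (h + i)) (\<lambda>i. l (h + i))"
    using kl \<open>p \<le> k h\<close> by (auto simp: subseq_pair_from_def strict_mono_def)
  then have tail_le: "norm (\<Sum>i<N - h. a (h + i) *\<^sub>R e (l (h + i)))
                      \<le> C * norm (\<Sum>i<N - h. a (h + i) *\<^sub>R e (k (h + i)))"
    using dominates_withD[OF tail[OF shifted], of "\<lambda>i. a (h + i)" "N - h"] by simp
  have "norm (\<Sum>i<N - h. a (h + i) *\<^sub>R e (k (h + i)))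
        = norm ((\<Sum>n<N. a n *\<^sub>R e (k n)) - (\<Sum>n<min N h. a n *\<^sub>R e (k n)))"
    by (simp add: sum_lessThan_split_at[of _ N h])
  also have "\<dots> \<le> X + p * B * E * X"
    using head[of k] norm_triangle_ineq4[of "\<Sum>n<N. a n *\<^sub>R e (k n)" "\<Sum>n<min N h. a n *\<^sub>R e (k n)"]
    unfolding X_def[symmetric] by linarith
  finally have tail_k: "norm (\<Sum>i<N - h. a (h + i) *\<^sub>R e (k (h + i))) \<le> X + p * B * E * X" .
  have "norm (\<Sum>n<N. a n *\<^sub>R e (l n))
        \<le> norm (\<Sum>n<min N h. a n *\<^sub>R e (l n)) + norm (\<Sum>i<N - h. a (h + i) *\<^sub>R e (l (h + i)))"
    unfolding sum_lessThan_split_at[of _ N h] by (rule norm_triangle_ineq)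
  also have "\<dots> \<le> p * B * E * X + C * (X + p * B * E * X)"
    using head[of l] tail_le mult_left_mono[OF tail_k \<open>0 \<le> C\<close>] by linarith
  also have "\<dots> = (p * B * E + C * (1 + p * B * E)) * X"
    by (simp add: algebra_simps)
  finally show "norm (\<Sum>n<N. a n *\<^sub>R e (l n)) \<le> (p * B * E + C * (1 + p * B * E)) * X" .
qed

section \<open>The basis constant of a basic sequence\<close>

locale basic_seq =
  fixes e :: "nat \<Rightarrow> 'a::banach"
  assumes basic: "basic_sequence e"
begin

definition closed_span :: "'a set" where
  "closed_span = closure (span (range e))"

text \<open>Outside closed_span, coord x is an unspecified THE-value; all lemmas below are restricted to
  closed_span.\<close>

definition coord :: "'a \<Rightarrow> nat \<Rightarrow> real" where
  "coord x = (THE a. (\<lambda>n. \<Sum>i<n. a i *\<^sub>R e i) \<longlonglongrightarrow> x)"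

definition proj :: "nat \<Rightarrow> 'a \<Rightarrow> 'a" where
  "proj n x = (\<Sum>i<n. coord x i *\<^sub>R e i)"

definition proj_sup :: "'a \<Rightarrow> real" where
  "proj_sup x = (SUP n. norm (proj n x))"

lemma expansion_unique: "x \<in> closed_span \<Longrightarrow> \<exists>!a. (\<lambda>n. \<Sum>i<n. a i *\<^sub>R e i) \<longlonglongrightarrow> x"
  using basic unfolding basic_sequence_def schauder_basis_of_def closed_span_def by blast

lemma proj_tendsto: "x \<in> closed_span \<Longrightarrow> (\<lambda>n. proj n x) \<longlonglongrightarrow> x"
  unfolding proj_def coord_def using theI'[OF expansion_unique] by blast

lemma coord_eqI: "x \<in> closed_span \<Longrightarrow> (\<lambda>n. \<Sum>i<n. a i *\<^sub>R e i) \<longlonglongrightarrow> x \<Longrightarrow> coord x = a"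
  using expansion_unique proj_tendsto unfolding proj_def by blast

lemma subspace_closed_span: "subspace closed_span"
  unfolding closed_span_def by (intro subspace_closure subspace_span)

lemma closed_closed_span: "closed closed_span"
  unfolding closed_span_def by simp

lemma zero_in_closed_span: "0 \<in> closed_span"
  using subspace_0[OF subspace_closed_span] .

lemma basis_in_closed_span: "e i \<in> closed_span"
  unfolding closed_span_def by (meson closure_subset rangeI span_base subsetD)

lemma coord_zero: "coord 0 = (\<lambda>i. 0)"
  by (rule coord_eqI[OF zero_in_closed_span]) simp

lemma basis_nonzero: "e i \<noteq> 0"
proof
  assume "e i = 0"
  then have zero: "(if j = i then 1 else 0) *\<^sub>R e j = 0" for j
    by simp
  have "coord 0 = (\<lambda>j. if j = i then 1 else 0)"
    by (rule coord_eqI[OF zero_in_closed_span]) (unfold zero, simp)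
  then show False
    using coord_zero by (metis zero_neq_one)
qed

lemma coord_add:
  assumes x: "x \<in> closed_span" and y: "y \<in> closed_span"
  shows "coord (x + y) = (\<lambda>i. coord x i + coord y i)"
proof (rule coord_eqI)
  show "x + y \<in> closed_span"
    using subspace_closed_span x y by (rule subspace_add)
  have "(\<lambda>n. proj n x + proj n y) \<longlonglongrightarrow> x + y"
    using proj_tendsto[OF x] proj_tendsto[OF y] by (rule tendsto_add)
  then show "(\<lambda>n. \<Sum>i<n. (coord x i + coord y i) *\<^sub>R e i) \<longlonglongrightarrow> x + y"
    by (simp add: proj_def sum.distrib scaleR_add_left)
qed

lemma coord_scale:
  assumes x: "x \<in> closed_span"
  shows "coord (c *\<^sub>R x) = (\<lambda>i. c * coord x i)"
proof (rule coord_eqI)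
  show "c *\<^sub>R x \<in> closed_span"
    using subspace_closed_span x by (rule subspace_scale)
  have "(\<lambda>n. c *\<^sub>R proj n x) \<longlonglongrightarrow> c *\<^sub>R x"
    using proj_tendsto[OF x] by (intro tendsto_scaleR tendsto_const)
  then show "(\<lambda>n. \<Sum>i<n. (c * coord x i) *\<^sub>R e i) \<longlonglongrightarrow> c *\<^sub>R x"
    by (simp add: proj_def scaleR_sum_right)
qed

lemma coord_sum:
  assumes "finite I" "\<And>j. j \<in> I \<Longrightarrow> x j \<in> closed_span"
  shows "coord (\<Sum>j\<in>I. x j) i = (\<Sum>j\<in>I. coord (x j) i)"
  using assms
proof (induction I rule: finite_induct)
  case empty
  then show ?case
    by (simp add: coord_zero)
next
  case (insert j I)
  have "(\<Sum>j\<in>I. x j) \<in> closed_span"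
    using insert.prems subspace_closed_span by (simp add: subspace_sum)
  then show ?case
    using insert by (simp add: coord_add)
qed

lemma coord_basis: "coord (e j) = (\<lambda>i. if i = j then 1 else 0)"
proof (rule coord_eqI[OF basis_in_closed_span])
  have "(\<Sum>i<n. (if i = j then 1 else 0) *\<^sub>R e i) = (\<Sum>i<n. if i = j then e j else 0)" for n
    by (rule sum.cong) auto
  then have "(\<Sum>i<n. (if i = j then 1 else 0) *\<^sub>R e i) = e j" if "j < n" for n
    using that by simp
  then show "(\<lambda>n. \<Sum>i<n. (if i = j then 1 else 0) *\<^sub>R e i) \<longlonglongrightarrow> e j"
    by (intro tendsto_eventually eventually_sequentiallyI[of "Suc j"]) simp
qed

lemma proj_add: "x \<in> closed_span \<Longrightarrow> y \<in> closed_span \<Longrightarrow> proj n (x + y) = proj n x + proj n y"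
  by (simp add: proj_def coord_add sum.distrib scaleR_add_left)

lemma proj_scale: "x \<in> closed_span \<Longrightarrow> proj n (c *\<^sub>R x) = c *\<^sub>R proj n x"
  by (simp add: proj_def coord_scale scaleR_sum_right)

lemma bdd_above_norm_proj: "x \<in> closed_span \<Longrightarrow> bdd_above (range (\<lambda>n. norm (proj n x)))"
  using proj_tendsto convergent_imp_Bseq convergentI Bseq_def
  by (metis bdd_aboveI2)

lemma norm_proj_le_proj_sup: "x \<in> closed_span \<Longrightarrow> norm (proj n x) \<le> proj_sup x"
  unfolding proj_sup_def by (rule cSUP_upper[OF _ bdd_above_norm_proj]) auto

lemma proj_sup_nonneg: "x \<in> closed_span \<Longrightarrow> 0 \<le> proj_sup x"
  using norm_proj_le_proj_sup norm_ge_zero order_trans by blast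

lemma norm_le_proj_sup: "x \<in> closed_span \<Longrightarrow> norm x \<le> proj_sup x"
  by (rule LIMSEQ_le_const2[OF tendsto_norm[OF proj_tendsto]]) (auto intro: norm_proj_le_proj_sup)

lemma proj_sup_add:
  assumes "x \<in> closed_span" "y \<in> closed_span"
  shows "proj_sup (x + y) \<le> proj_sup x + proj_sup y"
  unfolding proj_sup_def[of "x + y"]
proof (rule cSUP_least)
  fix n
  have "norm (proj n (x + y)) \<le> norm (proj n x) + norm (proj n y)"
    using assms by (simp add: proj_add norm_triangle_ineq)
  also have "\<dots> \<le> proj_sup x + proj_sup y"
    using assms by (intro add_mono norm_proj_le_proj_sup)
  finally show "norm (proj n (x + y)) \<le> proj_sup x + proj_sup y" .
qed simp

lemma proj_sup_scale:
  assumes "x \<in> closed_span"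
  shows "proj_sup (c *\<^sub>R x) \<le> \<bar>c\<bar> * proj_sup x"
  unfolding proj_sup_def[of "c *\<^sub>R x"]
proof (rule cSUP_least)
  show "norm (proj n (c *\<^sub>R x)) \<le> \<bar>c\<bar> * proj_sup x" for n
    using assms norm_proj_le_proj_sup[OF assms, of n] by (simp add: proj_scale mult_left_mono)
qed simp

lemma proj_sup_zero: "proj_sup 0 = 0"
  using proj_sup_scale[OF zero_in_closed_span, of 0] proj_sup_nonneg[OF zero_in_closed_span] by simp

lemma coord_bound:
  assumes x: "x \<in> closed_span"
  shows "\<bar>coord x i\<bar> * norm (e i) \<le> 2 * proj_sup x"
proof -
  have "\<bar>coord x i\<bar> * norm (e i) = norm (proj (Suc i) x - proj i x)"
    by (simp add: proj_def)
  also have "\<dots> \<le> norm (proj (Suc i) x) + norm (proj i x)"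
    by (rule norm_triangle_ineq4)
  also have "\<dots> \<le> 2 * proj_sup x"
    using norm_proj_le_proj_sup[OF x, of "Suc i"] norm_proj_le_proj_sup[OF x, of i] by simp
  finally show ?thesis .
qed

lemma summable_coord:
  assumes z: "\<And>j. z j \<in> closed_span" and sm: "summable (\<lambda>j. proj_sup (z j))"
  shows "summable (\<lambda>j. coord (z j) i)"
proof (rule summable_comparison_test)
  show "summable (\<lambda>j. 2 / norm (e i) * proj_sup (z j))"
    using sm by (rule summable_mult)
  show "\<exists>N. \<forall>j\<ge>N. norm (coord (z j) i) \<le> 2 / norm (e i) * proj_sup (z j)"
    using coord_bound[OF z] basis_nonzero[of i] by (simp add: field_simps)
qed

lemma suminf_proj_tendsto:
  assumes z: "\<And>j. z j \<in> closed_span" and sm: "summable (\<lambda>j. proj_sup (z j))" and y: "z sums y"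
  shows "(\<lambda>n. \<Sum>j. proj n (z j)) \<longlonglongrightarrow> y"
proof -
  have bound: "norm (proj n (z j) - z j) \<le> 2 * proj_sup (z j)" for n j
    using norm_triangle_ineq4[of "proj n (z j)" "z j"]
      norm_proj_le_proj_sup[OF z, of n j] norm_le_proj_sup[OF z, of j] by simp
  have sm2: "summable (\<lambda>j. 2 * proj_sup (z j))"
    using sm by (rule summable_mult)
  have "(\<lambda>n. \<Sum>j. norm (proj n (z j) - z j)) \<longlonglongrightarrow> (\<Sum>j. 0)"
  proof (rule tannerys_theorem[THEN conjunct2, THEN conjunct2])
    show "(\<lambda>n. norm (proj n (z j) - z j)) \<longlonglongrightarrow> 0" for j
      using proj_tendsto[OF z] by (intro tendsto_norm_zero LIM_zero)
    show "\<forall>\<^sub>F (j, n) in sequentially \<times>\<^sub>F sequentially.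
        norm (norm (proj n (z j) - z j)) \<le> 2 * proj_sup (z j)"
      by (rule always_eventually) (auto simp: bound)
  qed (use sm2 in auto)
  then have tendsto_0: "(\<lambda>n. \<Sum>j. norm (proj n (z j) - z j)) \<longlonglongrightarrow> 0"
    by simp
  have "norm ((\<Sum>j. proj n (z j)) - y) \<le> (\<Sum>j. norm (proj n (z j) - z j))" for n
  proof -
    have "summable (\<lambda>j. proj n (z j))"
      by (rule summable_norm_cancel, rule summable_comparison_test[OF _ sm])
         (simp add: norm_proj_le_proj_sup[OF z])
    then have "(\<lambda>j. proj n (z j) - z j) sums ((\<Sum>j. proj n (z j)) - y)"
      using y by (intro sums_diff summable_sums)
    moreover have "summable (\<lambda>j. norm (proj n (z j) - z j))"
      by (rule summable_comparison_test[OF _ sm2]) (auto simp: bound)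
    ultimately show ?thesis
      by (metis sums_unique summable_norm)
  qed
  then have "(\<lambda>n. (\<Sum>j. proj n (z j)) - y) \<longlonglongrightarrow> 0"
    by (intro Lim_null_comparison[OF always_eventually tendsto_0]) blast
  then show ?thesis
    by (rule LIM_zero_cancel)
qed

lemma proj_sums:
  assumes z: "\<And>j. z j \<in> closed_span" and sm: "summable (\<lambda>j. proj_sup (z j))" and y: "z sums y"
  shows "(\<lambda>j. proj n (z j)) sums proj n y"
proof -
  define d where "d i = (\<Sum>j. coord (z j) i)" for i
  have d_sums: "(\<lambda>j. proj n (z j)) sums (\<Sum>i<n. d i *\<^sub>R e i)" for n
    unfolding proj_def d_def
    by (intro sums_sum sums_scaleR_left summable_sums summable_coord[OF z sm])
  then have "(\<lambda>n. \<Sum>i<n. d i *\<^sub>R e i) \<longlonglongrightarrow> y"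
    using suminf_proj_tendsto[OF z sm y] by (simp add: sums_iff)
  moreover have "y \<in> closed_span"
  proof (rule closed_sequentially[OF closed_closed_span _ y[unfolded sums_def]])
    show "(\<Sum>j<J. z j) \<in> closed_span" for J
      using subspace_closed_span z by (simp add: subspace_sum)
  qed
  ultimately have "coord y = d"
    by (rule coord_eqI[rotated])
  then show ?thesis
    using d_sums by (simp add: proj_def)
qed

lemma proj_sup_suminf_le:
  assumes z: "\<And>j. z j \<in> closed_span" and sm: "summable (\<lambda>j. proj_sup (z j))" and y: "z sums y"
  shows "proj_sup y \<le> (\<Sum>j. proj_sup (z j))"
  unfolding proj_sup_def[of y]
proof (rule cSUP_least)
  fix n
  have "norm (proj n y) = norm (\<Sum>j. proj n (z j))"
    using proj_sums[OF z sm y] by (simp add: sums_iff)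
  also have "\<dots> \<le> (\<Sum>j. proj_sup (z j))"
    by (rule norm_suminf_le[OF norm_proj_le_proj_sup[OF z] sm])
  finally show "norm (proj n y) \<le> (\<Sum>j. proj_sup (z j))" .
qed simp

lemma Baire_proj_sup:
  obtains x0 r K where "x0 \<in> closed_span" "0 < r"
    "\<And>y. y \<in> closed_span \<Longrightarrow> dist y x0 < r \<Longrightarrow> y \<in> closure {x\<in>closed_span. proj_sup x \<le> K}"
proof -
  define F where "F K = closure {x\<in>closed_span. proj_sup x \<le> real K}" for K :: nat
  have "x \<in> (\<Union>K. F K)" if "x \<in> closed_span" for x
  proof -
    obtain K :: nat where "proj_sup x \<le> real K"
      using real_arch_simple by blast
    then have "x \<in> {x\<in>closed_span. proj_sup x \<le> real K}"
      using that by simp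
    then have "x \<in> F K"
      unfolding F_def by (rule subsetD[OF closure_subset])
    then show ?thesis
      by blast
  qed
  moreover have "F K \<subseteq> closed_span" for K
    unfolding F_def by (rule closure_minimal[OF _ closed_closed_span]) auto
  moreover have "closed_span \<noteq> {}"
    using zero_in_closed_span by blast
  ultimately obtain x0 r K where "x0 \<in> closed_span" "0 < r"
    "\<And>y. y \<in> closed_span \<Longrightarrow> dist y x0 < r \<Longrightarrow> y \<in> F K"
    using Baire_closed_cover[OF closed_closed_span, of F] unfolding F_def by blast
  then show thesis
    using that unfolding F_def by blast
qed

lemma convex_proj_sup_le: "convex {x\<in>closed_span. proj_sup x \<le> K}"
proof (rule convexI)
  fix x y and u v :: real
  assume x: "x \<in> {x\<in>closed_span. proj_sup x \<le> K}"
    and y: "y \<in> {x\<in>closed_span. proj_sup x \<le> K}"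
    and "0 \<le> u" "0 \<le> v" "u + v = 1"
  then have in_span: "u *\<^sub>R x \<in> closed_span" "v *\<^sub>R y \<in> closed_span"
    by (auto simp: subspace_scale[OF subspace_closed_span])
  have "proj_sup (u *\<^sub>R x + v *\<^sub>R y) \<le> u * proj_sup x + v * proj_sup y"
    using proj_sup_add[OF in_span] proj_sup_scale[of x u] proj_sup_scale[of y v] x y
      \<open>0 \<le> u\<close> \<open>0 \<le> v\<close> by auto
  also have "\<dots> \<le> u * K + v * K"
    using x y \<open>0 \<le> u\<close> \<open>0 \<le> v\<close> by (intro add_mono mult_left_mono) auto
  finally show "u *\<^sub>R x + v *\<^sub>R y \<in> {x\<in>closed_span. proj_sup x \<le> K}"
    using in_span \<open>u + v = 1\<close>
    by (simp add: subspace_add[OF subspace_closed_span] distrib_right[symmetric])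
qed

lemma closure_proj_sup_le_ball:
  "\<exists>K r. 0 \<le> K \<and> 0 < r \<and>
     (\<forall>y\<in>closed_span. norm y < r \<longrightarrow> y \<in> closure {x\<in>closed_span. proj_sup x \<le> K})"
proof -
  obtain x0 r K where x0: "x0 \<in> closed_span" and "0 < r"
    and near: "\<And>y. y \<in> closed_span \<Longrightarrow> dist y x0 < r \<Longrightarrow>
      y \<in> closure {x\<in>closed_span. proj_sup x \<le> K}"
    using Baire_proj_sup by blast
  define S where "S = {x\<in>closed_span. proj_sup x \<le> K}"
  have "(*\<^sub>R) (-1) ` S \<subseteq> S"
  proof
    fix x assume "x \<in> (*\<^sub>R) (-1) ` S"
    then obtain u where "u \<in> S" "x = - u"
      by auto
    then show "x \<in> S"
      using proj_sup_scale[of u "-1"] by (auto simp: S_def subspace_neg[OF subspace_closed_span])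
  qed
  then have neg: "- x \<in> closure S" if "x \<in> closure S" for x
  proof -
    have "- x \<in> (*\<^sub>R) (-1) ` closure S"
      using that by (metis image_eqI scaleR_minus1_left)
    then show ?thesis
      using closure_scaleR[of "-1" S] closure_mono[OF \<open>(*\<^sub>R) (-1) ` S \<subseteq> S\<close>] by blast
  qed
  have "x0 \<in> closure S"
    using near[OF x0] \<open>0 < r\<close> by (simp add: S_def)
  then obtain x where "x \<in> S"
    by (metis closure_empty empty_iff ex_in_conv)
  then have "0 \<le> K"
    using proj_sup_nonneg[of x] by (auto simp: S_def)
  moreover have "y \<in> closure S" if "y \<in> closed_span" "norm y < r" for y
  proof -
    have "x0 + y \<in> closure S" "x0 - y \<in> closure S"
      using near that x0 subspace_closed_span by (auto simp: S_def dist_norm subspace_add subspace_diff)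
    \<comment> \<open>closure S is convex and symmetric, and y is the midpoint of x0 + y and -(x0 - y).\<close>
    then have "(1/2) *\<^sub>R (x0 + y) + (1/2) *\<^sub>R (- (x0 - y)) \<in> closure S"
      using neg convex_closure[OF convex_proj_sup_le[of K, folded S_def]]
      by (intro convexD) (auto simp del: minus_diff_eq)
    then show ?thesis
      by (simp add: scaleR_right_diff_distrib scaleR_add_right flip: scaleR_add_left)
  qed
  ultimately show ?thesis
    using \<open>0 < r\<close> unfolding S_def by blast
qed

lemma closure_proj_sup_le_norm:
  "\<exists>A\<ge>0. \<forall>y\<in>closed_span. y \<in> closure {x\<in>closed_span. proj_sup x \<le> A * norm y}"
proof -
  obtain K r where "0 \<le> K" "0 < r"
    and ball: "\<And>y. y \<in> closed_span \<Longrightarrow> norm y < r \<Longrightarrow>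
      y \<in> closure {x\<in>closed_span. proj_sup x \<le> K}"
    using closure_proj_sup_le_ball by blast
  have "y \<in> closure {x\<in>closed_span. proj_sup x \<le> 2 * K / r * norm y}" if y: "y \<in> closed_span" for y
  proof (cases "y = 0")
    case True
    then show ?thesis
      using zero_in_closed_span closure_subset by (fastforce simp: proj_sup_zero)
  next
    case False
    define s where "s = 2 * norm y / r"
    have "0 < s"
      using False \<open>0 < r\<close> by (simp add: s_def)
    have "(1 / s) *\<^sub>R y \<in> closure {x\<in>closed_span. proj_sup x \<le> K}"
      using ball[OF subspace_scale[OF subspace_closed_span y]] False \<open>0 < r\<close> by (simp add: s_def)
    then have "y \<in> (*\<^sub>R) s ` closure {x\<in>closed_span. proj_sup x \<le> K}"
      using \<open>0 < s\<close> by (auto intro!: image_eqI[of y _ "(1 / s) *\<^sub>R y"])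
    also have "\<dots> = closure ((*\<^sub>R) s ` {x\<in>closed_span. proj_sup x \<le> K})"
      by (rule closure_scaleR)
    also have "\<dots> \<subseteq> closure {x\<in>closed_span. proj_sup x \<le> 2 * K / r * norm y}"
    proof (rule closure_mono, rule image_subsetI)
      fix x assume "x \<in> {x\<in>closed_span. proj_sup x \<le> K}"
      then have "x \<in> closed_span" "proj_sup x \<le> K"
        by auto
      then have "proj_sup (s *\<^sub>R x) \<le> s * K"
        using proj_sup_scale[of x s] \<open>0 < s\<close> by (smt (verit) mult_left_mono)
      then have "proj_sup (s *\<^sub>R x) \<le> 2 * K / r * norm y"
        by (simp add: s_def mult_ac)
      then show "s *\<^sub>R x \<in> {x\<in>closed_span. proj_sup x \<le> 2 * K / r * norm y}"
        using \<open>x \<in> closed_span\<close> subspace_scale[OF subspace_closed_span] by simp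
    qed
    finally show ?thesis .
  qed
  then show ?thesis
    using \<open>0 \<le> K\<close> \<open>0 < r\<close> by (intro exI[of _ "2 * K / r"]) auto
qed

lemma proj_sup_le_norm: "\<exists>A\<ge>0. \<forall>y\<in>closed_span. proj_sup y \<le> A * norm y"
proof -
  obtain A where "0 \<le> A"
    and near: "\<And>y. y \<in> closed_span \<Longrightarrow> y \<in> closure {x\<in>closed_span. proj_sup x \<le> A * norm y}"
    using closure_proj_sup_le_norm by blast
  have approx: "\<exists>w\<in>closed_span. proj_sup w \<le> A * norm u \<and> norm (u - w) \<le> norm u / 2"
    if u: "u \<in> closed_span" for u
  proof (cases "u = 0")
    case True
    then show ?thesis
      using zero_in_closed_span by (auto simp: proj_sup_zero)
  next
    case False
    then obtain w where "w \<in> closed_span" "proj_sup w \<le> A * norm u" "dist w u \<le> norm u / 2"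
      using near[OF u] unfolding closure_approachable_le by (metis (no_types, lifting) half_gt_zero mem_Collect_eq zero_less_norm_iff)
    then show ?thesis
      by (auto simp: dist_norm norm_minus_commute)
  qed
  have "proj_sup y \<le> 2 * A * norm y" if y: "y \<in> closed_span" for y
  proof -
    obtain z where z: "\<And>j. z j \<in> closed_span" and "z sums y"
      and z_le: "\<And>j. proj_sup (z j) \<le> A * norm y * (1/2) ^ j"
      using halving_approximation_sums[OF approx _ \<open>0 \<le> A\<close> y]
        subspace_diff[OF subspace_closed_span] by blast
    have geometric: "(\<lambda>j. A * norm y * (1/2::real) ^ j) sums (2 * A * norm y)"
      using sums_mult[OF geometric_sums[of "1/2::real"], of "A * norm y"] by (simp add: mult_ac)
    have summable: "summable (\<lambda>j. proj_sup (z j))"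
      using z_le proj_sup_nonneg[OF z] by (intro summable_comparison_test[OF _ sums_summable[OF geometric]]) auto
    have "proj_sup y \<le> (\<Sum>j. proj_sup (z j))"
      using z summable \<open>z sums y\<close> by (rule proj_sup_suminf_le)
    also have "\<dots> \<le> (\<Sum>j. A * norm y * (1/2) ^ j)"
      by (rule suminf_le[OF z_le summable sums_summable[OF geometric]])
    also have "\<dots> = 2 * A * norm y"
      using geometric by (rule sums_unique[symmetric])
    finally show ?thesis .
  qed
  then show ?thesis
    using \<open>0 \<le> A\<close> by (intro exI[of _ "2 * A"]) auto
qed

lemma coord_subseq_bound:
  "\<exists>A\<ge>0. \<forall>k (a :: nat \<Rightarrow> real) N n. inj k \<longrightarrow> n < N \<longrightarrow>
     \<bar>a n\<bar> * norm (e (k n)) \<le> A * norm (\<Sum>m<N. a m *\<^sub>R e (k m))"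
proof -
  obtain A where "0 \<le> A" and A: "\<And>y. y \<in> closed_span \<Longrightarrow> proj_sup y \<le> A * norm y"
    using proj_sup_le_norm by blast
  have "\<bar>a n\<bar> * norm (e (k n)) \<le> 2 * A * norm (\<Sum>m<N. a m *\<^sub>R e (k m))"
    if "inj k" "n < N" for k :: "nat \<Rightarrow> nat" and a N n
  proof -
    define x where "x = (\<Sum>m<N. a m *\<^sub>R e (k m))"
    have terms_in: "a m *\<^sub>R e (k m) \<in> closed_span" for m
      using subspace_scale[OF subspace_closed_span basis_in_closed_span] .
    then have "x \<in> closed_span"
      unfolding x_def using subspace_closed_span by (simp add: subspace_sum)
    have "coord x (k n) = (\<Sum>m<N. a m * coord (e (k m)) (k n))"
      unfolding x_def by (simp add: coord_sum terms_in coord_scale basis_in_closed_span)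
    also have "\<dots> = (\<Sum>m<N. if m = n then a m else 0)"
      using \<open>inj k\<close> by (intro sum.cong) (auto simp: coord_basis inj_eq)
    also have "\<dots> = a n"
      using \<open>n < N\<close> by simp
    finally have "\<bar>a n\<bar> * norm (e (k n)) \<le> 2 * proj_sup x"
      using coord_bound[OF \<open>x \<in> closed_span\<close>, of "k n"] by simp
    also have "\<dots> \<le> 2 * A * norm x"
      using A[OF \<open>x \<in> closed_span\<close>] by simp
    finally show ?thesis
      unfolding x_def .
  qed
  then show ?thesis
    using \<open>0 \<le> A\<close> by (intro exI[of _ "2 * A"]) auto
qed

lemma seminormalized_coeff_bound:
  assumes "seminormalized e"
  shows "\<exists>B\<ge>0. \<forall>k (a :: nat \<Rightarrow> real) N n. strict_mono k \<longrightarrow> n < N \<longrightarrow>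
           \<bar>a n\<bar> \<le> B * norm (\<Sum>m<N. a m *\<^sub>R e (k m))"
proof -
  obtain A where "0 \<le> A" and A: "\<And>k (a :: nat \<Rightarrow> real) N n. inj k \<Longrightarrow> n < N \<Longrightarrow>
      \<bar>a n\<bar> * norm (e (k n)) \<le> A * norm (\<Sum>m<N. a m *\<^sub>R e (k m))"
    using coord_subseq_bound by blast
  define \<delta> where "\<delta> = (INF i. norm (e i))"
  have "0 < \<delta>"
    using assms unfolding seminormalized_def \<delta>_def by simp
  have \<delta>_le: "\<delta> \<le> norm (e i)" for i
    unfolding \<delta>_def by (rule cINF_lower) (auto intro: bdd_belowI[of _ 0])
  have "\<bar>a n\<bar> \<le> A / \<delta> * norm (\<Sum>m<N. a m *\<^sub>R e (k m))"
    if "strict_mono k" "n < N" for k :: "nat \<Rightarrow> nat" and a :: "nat \<Rightarrow> real" and N n :: nat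
  proof -
    have "\<bar>a n\<bar> * \<delta> \<le> A * norm (\<Sum>m<N. a m *\<^sub>R e (k m))"
      using A[OF strict_mono_imp_inj_on[OF that(1)] that(2)] \<delta>_le[of "k n"]
      by (meson abs_ge_zero mult_left_mono order_trans)
    then show ?thesis
      using \<open>0 < \<delta>\<close> by (simp add: field_simps)
  qed
  then show ?thesis
    using \<open>0 \<le> A\<close> \<open>0 < \<delta>\<close> by (intro exI[of _ "A / \<delta>"]) auto
qed

end

theorem lemma2p2:
  fixes e :: "nat \<Rightarrow> 'a::banach"
  assumes "basic_sequence e" and "seminormalized e" and "quasisubsymmetric e"
  shows "\<exists>S>0. \<forall>k l::nat \<Rightarrow> nat. strict_mono k \<and> strict_mono l \<and> (\<forall>n. k n \<le> l n) \<longrightarrow>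
           (\<forall>(a::nat \<Rightarrow> real) N. norm (\<Sum>n<N. a n *\<^sub>R e (l n)) \<le> S * norm (\<Sum>n<N. a n *\<^sub>R e (k n)))"
proof -
  interpret basic_seq e
    by (rule basic_seq.intro) fact
  obtain B where "0 \<le> B" and coeff: "\<And>k (a :: nat \<Rightarrow> real) N n. strict_mono k \<Longrightarrow> n < N \<Longrightarrow>
      \<bar>a n\<bar> \<le> B * norm (\<Sum>m<N. a m *\<^sub>R e (k m))"
    using seminormalized_coeff_bound[OF assms(2)] by blast
  obtain E where E: "\<And>i. norm (e i) \<le> E"
    using assms(2) unfolding seminormalized_def bdd_above_def by auto
  have "dominates (e \<circ> k) (e \<circ> l)" if "subseq_pair_from 0 k l" for k l
    using assms(3) that unfolding quasisubsymmetric_def subseq_pair_from_def by blast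
  then obtain p C where "0 < C"
    and tail: "\<And>k l. subseq_pair_from p k l \<Longrightarrow> dominates_with C (e \<circ> k) (e \<circ> l)"
    using uniform_domination_from by blast
  define S where "S = p * B * E + C * (1 + p * B * E)"
  have "0 < S"
    using \<open>0 < C\<close> \<open>0 \<le> B\<close> E[of 0] norm_ge_zero[of "e 0"] unfolding S_def
    by (smt (verit) mult_nonneg_nonneg mult_pos_pos of_nat_0_le_iff)
  moreover have "dominates_with S (e \<circ> k) (e \<circ> l)" if "subseq_pair_from 0 k l" for k l
    unfolding S_def using coeff E tail \<open>0 \<le> B\<close> \<open>0 < C\<close> that by (intro dominates_with_of_tail) auto
  ultimately show ?thesis
    unfolding dominates_with_def subseq_pair_from_def by auto
qed

end
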